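(* Let $k\ge 0$ be an integer, let $n=8k+4$, and let $G$ be a graph of order $n$. If $G$ is Hadamard diagonalizable, then $G$ is one of the four graphs $K_n$, $K_{n/2,n/2}$, $nK_1$, $2K_{n/2}$.
   Context: Graphs are finite and simple. A (real) Hadamard matrix of order $n$ is an $n\times n$ matrix $H$ with entries in $\{1,-1\}$ such that $H^TH=nI$. The Laplacian matrix $L$ of a graph $G$ is defined by $L_{uu}=\deg(u)$, $L_{uv}=-1$ if $u\neq v$ are adjacent, and $L_{uv}=0$ otherwise. $G$ is Hadamard diagonalizable if there is a Hadamard matrix $H$ of order $n=|V(G)|$ such that $\frac1n H^TLH$ is a diagonal matrix (equivalently, $L$ has $n$ mutually orthogonal eigenvectors with all entries in $\{\pm1\}$). $K_n$ is the complete graph, $K_{a,b}$ the complete bipartite graph, $nK_1$ the edgeless graph on $n$ vertices, and $2K_{n/2}$ the disjoint union of two copies of $K_{n/2}$. *)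

theory Defs
  imports "Graph_Theory.Kuratowski" "Jordan_Normal_Form.Matrix"
begin

definition hadamard_mat :: "nat \<Rightarrow> real mat \<Rightarrow> bool" where
  "hadamard_mat n H \<longleftrightarrow>
     H \<in> carrier_mat n n \<and>
     (\<forall>i<n. \<forall>j<n. H $$ (i, j) \<in> {1, -1}) \<and>
     H\<^sup>T * H = real n \<cdot>\<^sub>m 1\<^sub>m n"

text \<open>
  Finite simple graphs are symmetric loop-free digraphs without parallel arcs (locale
  \<open>graph\<close>), so an edge is a pair of opposite arcs and the degree of a vertex is its out-degree.
  Rows and columns of the Laplacian follow an enumeration \<open>vs\<close> of the vertices.
\<close>

definition laplacian_mat :: "('a, 'b) pre_digraph \<Rightarrow> 'a list \<Rightarrow> real mat" where
  "laplacian_mat G vs = mat (length vs) (length vs) (\<lambda>(i, j).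
     if i = j then real (out_degree G (vs ! i))
     else if (vs ! i, vs ! j) \<in> arcs_ends G then -1
     else 0)"

text \<open>
  The choice of enumeration is immaterial: reordering the vertices conjugates the Laplacian by a
  permutation matrix \<open>P\<close>, and \<open>P * H\<close> is again a Hadamard matrix.
\<close>

definition hadamard_diagonalizable :: "('a, 'b) pre_digraph \<Rightarrow> bool" where
  "hadamard_diagonalizable G \<longleftrightarrow>
     (\<exists>vs H. distinct vs \<and> set vs = verts G \<and>
        hadamard_mat (card (verts G)) H \<and>
        diagonal_mat ((1 / real (card (verts G))) \<cdot>\<^sub>m (H\<^sup>T * laplacian_mat G vs * H)))"

text \<open>
  The graphs \<open>n K\<^sub>1\<close> and \<open>2 K\<^sub>m\<close> up to isomorphism, in the style of
  \<open>complete_digraph\<close> and \<open>complete_bipartite_digraph\<close>.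
\<close>

definition edgeless_digraph :: "nat \<Rightarrow> ('a, 'b) pre_digraph \<Rightarrow> bool" where
  "edgeless_digraph n G \<longleftrightarrow> graph G \<and> card (verts G) = n \<and> arcs_ends G = {}"

definition two_complete_digraph :: "nat \<Rightarrow> ('a, 'b) pre_digraph \<Rightarrow> bool" where
  "two_complete_digraph m G \<longleftrightarrow> graph G \<and>
     (\<exists>U V. verts G = U \<union> V \<and> U \<inter> V = {} \<and> card U = m \<and> card V = m \<and>
        arcs_ends G = {(u, v). (u, v) \<in> U \<times> U \<union> V \<times> V \<and> u \<noteq> v})"

end

theory Submission
  imports Defs "Jordan_Normal_Form.Determinant"
begin

text \<open>
  Write \<open>L\<close> for the Laplacian and \<open>\<theta>\<^sub>i\<close> for the eigenvalue of the \<open>i\<close>-th column of \<open>H\<close>. The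
  eigenvector equation at a vertex \<open>w\<close> gives \<open>\<theta>\<^sub>i = (\<Sum>z. L\<^sub>w\<^sub>z H\<^sub>z\<^sub>i H\<^sub>w\<^sub>i)\<close>; substituting this into
  \<open>n L\<^sub>u\<^sub>v = (\<Sum>i. \<theta>\<^sub>i H\<^sub>u\<^sub>i H\<^sub>v\<^sub>i)\<close> expresses \<open>n L\<^sub>u\<^sub>v\<close> as the sum over \<open>z\<close> of \<open>L\<^sub>w\<^sub>z\<close> times the total
  \<open>T\<^sub>z\<close> of the product of the rows \<open>z\<close>, \<open>w\<close>, \<open>u\<close>, \<open>v\<close>. For distinct \<open>u\<close>, \<open>v\<close>, \<open>w\<close> the total vanishes when
  \<open>z\<close> is one of them, and otherwise it is 4 modulo 8, since \<open>a (a + b) (a + c) (a + d)\<close> is divisible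
  by 8 for signs \<open>a\<close>, \<open>b\<close>, \<open>c\<close>, \<open>d\<close> and \<open>n\<close> is 4 modulo 8. As \<open>n / 4\<close> is odd, dividing by 4 and reducing
  modulo 2 shows that the number of edges in any triple of vertices has the parity of \<open>L\<^sub>w\<^sub>w\<close>, the degree
  of \<open>w\<close>. The case \<open>u = v\<close> of the expansion shows that the graph is regular. If the degree is odd,
  the closed neighbourhood of a vertex and its complement are cliques without edges between them;
  if it is even, a neighbourhood and its complement are the parts of a complete bipartite graph.
  Regularity then forces the two parts to have equal size unless one of them is empty.
\<close>

section \<open>Parity of triples for integer matrices with sign eigenvectors\<close>

lemma sum_prod_four_orthogonal_signs:
  fixes a b c d :: "'i \<Rightarrow> int"
  assumes sgn: "\<And>i. i \<in> I \<Longrightarrow> \<bar>a i\<bar> = 1" "\<And>i. i \<in> I \<Longrightarrow> \<bar>b i\<bar> = 1"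
      "\<And>i. i \<in> I \<Longrightarrow> \<bar>c i\<bar> = 1" "\<And>i. i \<in> I \<Longrightarrow> \<bar>d i\<bar> = 1"
    and orth: "(\<Sum>i\<in>I. a i * b i) = 0" "(\<Sum>i\<in>I. a i * c i) = 0" "(\<Sum>i\<in>I. a i * d i) = 0"
      "(\<Sum>i\<in>I. b i * c i) = 0" "(\<Sum>i\<in>I. b i * d i) = 0" "(\<Sum>i\<in>I. c i * d i) = 0"
  shows "8 dvd int (card I) + (\<Sum>i\<in>I. a i * b i * c i * d i)"
proof -
  have pm: "x = 1 \<or> x = -1" if "\<bar>x\<bar> = 1" for x :: int
    using that by linarith
  have expand: "a i * ((a i + b i) * (a i + c i) * (a i + d i)) =
      1 + a i * b i + a i * c i + a i * d i + b i * c i + b i * d i + c i * d i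
        + a i * b i * c i * d i" if "i \<in> I" for i
    using pm[OF sgn(1)[OF that]] by (elim disjE) (simp_all add: algebra_simps)
  \<comment> \<open>Each of the three factors is a sum of two signs, hence even.\<close>
  have "8 dvd a i * ((a i + b i) * (a i + c i) * (a i + d i))" if "i \<in> I" for i
    using sgn[OF that, THEN pm] by (elim disjE) simp_all
  then have "8 dvd (\<Sum>i\<in>I. a i * ((a i + b i) * (a i + c i) * (a i + d i)))"
    by (rule dvd_sum)
  also have "\<dots> = int (card I) + (\<Sum>i\<in>I. a i * b i * c i * d i)"
    by (simp add: expand sum.distrib orth)
  finally show ?thesis .
qed

text \<open>With \<open>D\<close> the diagonal matrix of the \<open>ev i\<close>, multiplying
  \<open>l h = h D\<close> by the transpose of \<open>h\<close> turns the left side into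
  \<open>n l\<close>, because the rows of \<open>h\<close> are orthogonal. No division occurs, so
  this works over the integers.\<close>

lemma diagonalized_entry:
  fixes h l :: "nat \<Rightarrow> nat \<Rightarrow> 'a :: comm_ring_1"
  assumes orth: "\<And>u v. u < n \<Longrightarrow> v < n \<Longrightarrow>
      (\<Sum>i<n. h u i * h v i) = (if u = v then of_nat n else 0)"
    and eig: "\<And>w i. w < n \<Longrightarrow> i < n \<Longrightarrow> (\<Sum>z<n. l w z * h z i) = h w i * ev i"
    and "u < n" "v < n"
  shows "of_nat n * l u v = (\<Sum>i<n. ev i * (h u i * h v i))"
proof -
  have "(\<Sum>i<n. ev i * (h u i * h v i)) = (\<Sum>i<n. (\<Sum>z<n. l u z * h z i) * h v i)"
    using \<open>u < n\<close> by (intro sum.cong) (simp_all add: eig mult.assoc mult.left_commute)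
  also have "\<dots> = (\<Sum>i<n. \<Sum>z<n. l u z * (h z i * h v i))"
    by (simp add: sum_distrib_right mult.assoc)
  also have "\<dots> = (\<Sum>z<n. l u z * (\<Sum>i<n. h z i * h v i))"
    by (subst sum.swap) (simp add: sum_distrib_left)
  also have "\<dots> = (\<Sum>z<n. if z = v then l u z * of_nat n else 0)"
    using \<open>v < n\<close> by (intro sum.cong) (simp_all add: orth)
  also have "\<dots> = of_nat n * l u v"
    using \<open>v < n\<close> by (simp add: mult.commute)
  finally show ?thesis ..
qed

text \<open>Only entries modulo 2 count, so the minus signs off the diagonal of a Laplacian are
  harmless, and zero row sums are all that is kept of its shape. The eigenvalues are expanded along
  row \<open>w\<close>, whence the diagonal entry \<open>l w w\<close>.\<close>

lemma diagonalized_triple_parity: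
  fixes h l :: "nat \<Rightarrow> nat \<Rightarrow> int"
  assumes n: "n = 8 * k + 4"
    and sgn: "\<And>u i. u < n \<Longrightarrow> i < n \<Longrightarrow> \<bar>h u i\<bar> = 1"
    and orth: "\<And>u v. u < n \<Longrightarrow> v < n \<Longrightarrow>
      (\<Sum>i<n. h u i * h v i) = (if u = v then int n else 0)"
    and eig: "\<And>w i. w < n \<Longrightarrow> i < n \<Longrightarrow> (\<Sum>z<n. l w z * h z i) = h w i * ev i"
    and row: "\<And>w. w < n \<Longrightarrow> (\<Sum>z<n. l w z) = 0"
    and uvw: "u < n" "v < n" "w < n" "u \<noteq> v" "u \<noteq> w" "v \<noteq> w"
  shows "even (l u v + l w u + l w v + l w w)"
proof -
  define T where "T z = (\<Sum>i<n. h z i * h w i * h u i * h v i)" for z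
  define R where "R = {..<n} - {u, v, w}"
  have sq: "h z i * h z i = 1" if "z < n" "i < n" for z i
    using sgn[OF that] by (metis abs_mult_self_eq mult_1)
  have ev: "ev i = (\<Sum>z<n. l w z * (h z i * h w i))" if "i < n" for i
  proof -
    have "ev i = h w i * h w i * ev i"
      using sq[OF \<open>w < n\<close> that] by simp
    also have "\<dots> = (\<Sum>z<n. l w z * h z i) * h w i"
      unfolding eig[OF \<open>w < n\<close> that] by (simp only: mult_ac)
    finally show ?thesis
      by (simp add: sum_distrib_right mult.assoc)
  qed
  \<comment> \<open>A repeated row contributes the factor 1, leaving the inner product of two
    distinct rows.\<close>
  have T0: "T z = 0" if "z \<in> {u, v, w}" for z
  proof -
    have "T u = (\<Sum>i<n. h u i * h u i * (h w i * h v i))"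
      "T v = (\<Sum>i<n. h v i * h v i * (h w i * h u i))"
      "T w = (\<Sum>i<n. h w i * h w i * (h u i * h v i))"
      unfolding T_def by (simp_all only: mult_ac)
    then have "T u = (\<Sum>i<n. h w i * h v i)" "T v = (\<Sum>i<n. h w i * h u i)"
      "T w = (\<Sum>i<n. h u i * h v i)"
      using uvw by (simp_all add: sq)
    then show ?thesis
      using that uvw by (auto simp: orth)
  qed
  have T4: "\<exists>t. T z = 4 * (2 * t + 1)" if "z \<in> R" for z
  proof -
    have "8 dvd int (card {..<n}) + T z"
      unfolding T_def using that uvw
      by (intro sum_prod_four_orthogonal_signs) (auto simp: R_def sgn orth)
    then obtain q where "int n + T z = 8 * q"
      by auto
    then have "T z = 4 * (2 * (q - int k - 1) + 1)"
      by (simp add: n)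
    then show ?thesis ..
  qed
  then obtain t where t: "\<And>z. z \<in> R \<Longrightarrow> T z = 4 * (2 * t z + 1)"
    by metis
  have split: "{..<n} = R \<union> {u, v, w}" "R \<inter> {u, v, w} = {}" "finite R"
    using uvw by (auto simp: R_def)
  have "int n * l u v = (\<Sum>i<n. ev i * (h u i * h v i))"
    using diagonalized_entry[of n h l ev u v] orth eig uvw by simp
  also have "\<dots> = (\<Sum>i<n. \<Sum>z<n. l w z * (h z i * h w i * h u i * h v i))"
    by (intro sum.cong) (simp_all add: ev sum_distrib_left sum_distrib_right mult_ac)
  also have "\<dots> = (\<Sum>z<n. l w z * T z)"
    unfolding T_def by (subst sum.swap) (simp add: sum_distrib_left)
  also have "\<dots> = (\<Sum>z\<in>R. l w z * T z)"
    by (intro sum.mono_neutral_right) (auto simp: R_def T0)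
  also have "\<dots> = (\<Sum>z\<in>R. 4 * (2 * (l w z * t z) + l w z))"
    by (intro sum.cong) (simp_all add: t algebra_simps)
  also have "\<dots> = 4 * (2 * (\<Sum>z\<in>R. l w z * t z) + (\<Sum>z\<in>R. l w z))"
    by (simp add: sum_distrib_left sum.distrib)
  also have "int n * l u v = 4 * ((2 * int k + 1) * l u v)"
    by (simp add: n)
  finally have "(2 * int k + 1) * l u v = 2 * (\<Sum>z\<in>R. l w z * t z) + (\<Sum>z\<in>R. l w z)"
    by (simp only: mult_cancel_left) simp
  \<comment> \<open>The zero row sum trades the unknown sum over \<open>R\<close> for the three
    entries of row \<open>w\<close> at \<open>u\<close>, \<open>v\<close> and
    \<open>w\<close>.\<close>
  moreover have "(\<Sum>z<n. l w z) = (\<Sum>z\<in>R. l w z) + (\<Sum>z\<in>{u, v, w}. l w z)"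
    unfolding split(1) by (rule sum.union_disjoint) (use split in simp_all)
  then have "(\<Sum>z\<in>R. l w z) = - (l w u + l w v + l w w)"
    using row[OF \<open>w < n\<close>] uvw by simp
  ultimately have "l u v + l w u + l w v + l w w = 2 * ((\<Sum>z\<in>R. l w z * t z) - int k * l u v)"
    by (simp add: algebra_simps)
  then show ?thesis
    by simp
qed

section \<open>Passage from real Hadamard matrices to integer sign matrices\<close>

text \<open>A left inverse of a square matrix is also a right inverse. Order 0 is separate because
  of the scaling by \<open>1 / real n\<close>.\<close>

lemma hadamard_mat_rows_orthogonal:
  assumes "hadamard_mat n H"
  shows "H * H\<^sup>T = real n \<cdot>\<^sub>m 1\<^sub>m n"
proof (cases "n = 0")
  case True
  with assms show ?thesis
    by (intro eq_matI) (auto simp: hadamard_mat_def)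
next
  case False
  have H: "H \<in> carrier_mat n n" and HH: "H\<^sup>T * H = real n \<cdot>\<^sub>m 1\<^sub>m n"
    using assms by (auto simp: hadamard_mat_def)
  have "((1 / real n) \<cdot>\<^sub>m H\<^sup>T) * H = 1\<^sub>m n"
  proof -
    have "((1 / real n) \<cdot>\<^sub>m H\<^sup>T) * H = (1 / real n) \<cdot>\<^sub>m (H\<^sup>T * H)"
      using H by (intro mult_smult_assoc_mat[of _ n n _ n]) auto
    also have "\<dots> = 1\<^sub>m n"
      unfolding HH using False by (intro eq_matI) auto
    finally show ?thesis .
  qed
  then have "H * ((1 / real n) \<cdot>\<^sub>m H\<^sup>T) = 1\<^sub>m n"
    using H by (intro mat_mult_left_right_inverse[of "(1 / real n) \<cdot>\<^sub>m H\<^sup>T"]) auto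
  then have "(1 / real n) \<cdot>\<^sub>m (H * H\<^sup>T) = 1\<^sub>m n"
    using H by (subst (asm) mult_smult_distrib[of _ n n _ n]) auto
  then have "real n \<cdot>\<^sub>m ((1 / real n) \<cdot>\<^sub>m (H * H\<^sup>T)) = real n \<cdot>\<^sub>m 1\<^sub>m n"
    by simp
  moreover have "real n \<cdot>\<^sub>m ((1 / real n) \<cdot>\<^sub>m (H * H\<^sup>T)) = H * H\<^sup>T"
    using H False by (intro eq_matI) auto
  ultimately show ?thesis
    by simp
qed

text \<open>Multiplying the diagonal matrix \<open>D\<close> by \<open>H\<close> on the left cancels
  the transpose by row orthogonality and gives \<open>H * D = L * H\<close>, read here entry by
  entry.\<close>

lemma hadamard_mat_eigenvectors:
  assumes "hadamard_mat n H" and L: "L \<in> carrier_mat n n"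
    and diag: "diagonal_mat ((1 / real n) \<cdot>\<^sub>m (H\<^sup>T * L * H))"
  obtains ev where "\<And>w i. w < n \<Longrightarrow> i < n \<Longrightarrow>
    (\<Sum>z<n. L $$ (w, z) * H $$ (z, i)) = H $$ (w, i) * ev i"
proof (cases "n = 0")
  case True
  then show ?thesis
    using that by simp
next
  case False
  have H: "H \<in> carrier_mat n n"
    using assms by (simp add: hadamard_mat_def)
  define D where "D = (1 / real n) \<cdot>\<^sub>m (H\<^sup>T * L * H)"
  have D: "D \<in> carrier_mat n n"
    using H L by (simp add: D_def)
  have "H * D = (1 / real n) \<cdot>\<^sub>m (H * (H\<^sup>T * L * H))"
    unfolding D_def using H L by (intro mult_smult_distrib[of _ n n _ n]) auto
  also have "H * (H\<^sup>T * L * H) = (H * H\<^sup>T) * (L * H)"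
    using H L by (simp add: assoc_mult_mat[of _ n n _ n _ n])
  also have "\<dots> = real n \<cdot>\<^sub>m (L * H)"
    using H L by (simp add: hadamard_mat_rows_orthogonal[OF assms(1)] mult_smult_assoc_mat[of _ n n _ n])
  also have "(1 / real n) \<cdot>\<^sub>m (real n \<cdot>\<^sub>m (L * H)) = L * H"
    using H L False by (intro eq_matI) auto
  finally have eq: "H * D = L * H" .
  have "(\<Sum>z<n. L $$ (w, z) * H $$ (z, i)) = H $$ (w, i) * D $$ (i, i)" if "w < n" "i < n" for w i
  proof -
    have "(\<Sum>z<n. L $$ (w, z) * H $$ (z, i)) = (L * H) $$ (w, i)"
      using H L that by (simp add: scalar_prod_def atLeast0LessThan)
    also have "\<dots> = (\<Sum>z<n. H $$ (w, z) * D $$ (z, i))"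
      using H D that by (simp add: eq[symmetric] scalar_prod_def atLeast0LessThan)
    also have "\<dots> = (\<Sum>z<n. if z = i then H $$ (w, i) * D $$ (i, i) else 0)"
      using diag D that by (intro sum.cong) (auto simp: diagonal_mat_def D_def[symmetric])
    finally show ?thesis
      using that by simp
  qed
  then show ?thesis
    by (rule that)
qed

text \<open>Parity arguments need integers throughout: an eigenvalue of an integer matrix with a
  sign eigenvector is, up to sign, an integer sum.\<close>

lemma hadamard_diagonalized_int_mat:
  fixes l :: "nat \<Rightarrow> nat \<Rightarrow> int"
  assumes "hadamard_mat n H"
    and "diagonal_mat ((1 / real n) \<cdot>\<^sub>m (H\<^sup>T * mat n n (\<lambda>(i, j). real_of_int (l i j)) * H))"
  obtains h ev where "\<And>u i. u < n \<Longrightarrow> i < n \<Longrightarrow> \<bar>h u i\<bar> = 1"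
    and "\<And>u v. u < n \<Longrightarrow> v < n \<Longrightarrow> (\<Sum>i<n. h u i * h v i) = (if u = v then int n else 0)"
    and "\<And>w i. w < n \<Longrightarrow> i < n \<Longrightarrow> (\<Sum>z<n. l w z * h z i) = h w i * ev i"
proof -
  have H: "H \<in> carrier_mat n n"
    using assms by (simp add: hadamard_mat_def)
  define h where "h u i = \<lfloor>H $$ (u, i)\<rfloor>" for u i
  have pm: "H $$ (u, i) = 1 \<or> H $$ (u, i) = -1" if "u < n" "i < n" for u i
    using assms(1) that by (auto simp: hadamard_mat_def)
  have h: "H $$ (u, i) = real_of_int (h u i)" if "u < n" "i < n" for u i
    using pm[OF that] floor_of_int[of "- 1", where ?'a = real] by (auto simp: h_def)
  have sgn: "\<bar>h u i\<bar> = 1" if "u < n" "i < n" for u i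
    using pm[OF that] floor_of_int[of "- 1", where ?'a = real] by (auto simp: h_def)
  obtain e where e: "\<And>w i. w < n \<Longrightarrow> i < n \<Longrightarrow>
      (\<Sum>z<n. real_of_int (l w z) * H $$ (z, i)) = H $$ (w, i) * e i"
  proof (rule hadamard_mat_eigenvectors[OF assms(1) _ assms(2)])
    fix e
    assume *: "\<And>w i. w < n \<Longrightarrow> i < n \<Longrightarrow> (\<Sum>z<n. mat n n (\<lambda>(i, j). real_of_int (l i j)) $$ (w, z) *
      H $$ (z, i)) = H $$ (w, i) * e i"
    show thesis
      by (rule that[of e]) (use * in simp)
  qed simp
  have e': "real_of_int (\<Sum>z<n. l w z * h z i) = real_of_int (h w i) * e i" if "w < n" "i < n" for w i
    using e[OF that] that by (simp add: h)
  have orth: "(\<Sum>i<n. h u i * h v i) = (if u = v then int n else 0)" if "u < n" "v < n" for u v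
  proof -
    have "real_of_int (\<Sum>i<n. h u i * h v i) = (H * H\<^sup>T) $$ (u, v)"
      using H that by (simp add: scalar_prod_def atLeast0LessThan h)
    also have "\<dots> = real_of_int (if u = v then int n else 0)"
      using that by (simp add: hadamard_mat_rows_orthogonal[OF assms(1)])
    finally show ?thesis
      by (simp only: of_int_eq_iff)
  qed
  have e_int: "e i = real_of_int \<lfloor>e i\<rfloor>" if "i < n" for i
  proof -
    \<comment> \<open>Any row determines the eigenvalue; row \<open>i\<close> is at hand because
      \<open>i < n\<close>.\<close>
    have "h i i = 1 \<or> h i i = -1"
      using sgn[OF that that] by linarith
    then have "e i = real_of_int (h i i * (\<Sum>z<n. l i z * h z i))"
      using e'[OF that that] by auto
    then show ?thesis
      by (metis floor_of_int)
  qed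
  have "(\<Sum>z<n. l w z * h z i) = h w i * \<lfloor>e i\<rfloor>" if "w < n" "i < n" for w i
  proof -
    have "real_of_int (\<Sum>z<n. l w z * h z i) = real_of_int (h w i * \<lfloor>e i\<rfloor>)"
      using e'[OF that] e_int[OF \<open>i < n\<close>] by (metis of_int_mult)
    then show ?thesis
      by (simp only: of_int_eq_iff)
  qed
  with sgn orth show thesis
    by (rule that)
qed

section \<open>Regularity and triple parity of the graph\<close>

lemma (in digraph) out_degree_eq_card_dominated:
  "out_degree G u = card {v. u \<rightarrow>\<^bsub>G\<^esub> v}"
proof -
  have "{v. u \<rightarrow>\<^bsub>G\<^esub> v} = head G ` out_arcs G u"
    by (force simp: arcs_ends_def arc_to_ends_def)
  moreover have "inj_on (head G) (out_arcs G u)"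
    by (auto intro!: inj_onI no_multi_arcs simp: arc_to_ends_def)
  ultimately show ?thesis
    by (simp add: out_degree_def card_image)
qed

lemma (in graph) hadamard_diagonalizable_triple_parity:
  assumes n: "card (verts G) = 8 * k + 4" and "hadamard_diagonalizable G"
  obtains r where "\<And>u. u \<in> verts G \<Longrightarrow> card {v. u \<rightarrow>\<^bsub>G\<^esub> v} = r"
    and "\<And>u v w. \<lbrakk>u \<in> verts G; v \<in> verts G; w \<in> verts G; u \<noteq> v; u \<noteq> w; v \<noteq> w\<rbrakk> \<Longrightarrow>
      even (of_bool (u \<rightarrow>\<^bsub>G\<^esub> v) + of_bool (w \<rightarrow>\<^bsub>G\<^esub> u) + of_bool (w \<rightarrow>\<^bsub>G\<^esub> v) + r)"
proof -
  define n where "n = 8 * k + 4"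
  obtain vs H where vs: "distinct vs" "set vs = verts G" and H: "hadamard_mat n H"
    and diag: "diagonal_mat ((1 / real n) \<cdot>\<^sub>m (H\<^sup>T * laplacian_mat G vs * H))"
    using assms by (auto simp: hadamard_diagonalizable_def n_def)
  have len: "length vs = n"
    using vs n distinct_card[of vs] by (simp add: n_def)
  define l where "l i j = (if i = j then int (out_degree G (vs ! i)) else - of_bool (vs ! i \<rightarrow>\<^bsub>G\<^esub> vs ! j))" for i j
  have "laplacian_mat G vs = mat n n (\<lambda>(i, j). real_of_int (l i j))"
    by (intro eq_matI) (auto simp: laplacian_mat_def l_def len)
  with diag obtain h ev where sgn: "\<And>u i. u < n \<Longrightarrow> i < n \<Longrightarrow> \<bar>h u i :: int\<bar> = 1"
    and orth: "\<And>u v. u < n \<Longrightarrow> v < n \<Longrightarrow> (\<Sum>i<n. h u i * h v i) = (if u = v then int n else 0)"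
    and eig: "\<And>w i. w < n \<Longrightarrow> i < n \<Longrightarrow> (\<Sum>z<n. l w z * h z i) = h w i * ev i"
    using hadamard_diagonalized_int_mat[OF H, of l] by auto
  have noloop: "\<not> u \<rightarrow>\<^bsub>G\<^esub> u" for u
    using no_loops by (auto simp: arcs_ends_def arc_to_ends_def)
  have row: "(\<Sum>z<n. l w z) = 0" if "w < n" for w
  proof -
    have bij: "bij_betw ((!) vs) {..<n} (verts G)"
      using bij_betw_nth[OF vs(1), of "{..<n}"] vs(2) len by simp
    \<comment> \<open>The absence of loops allows the adjacency term to be subtracted at
      \<open>z = w\<close> too.\<close>
    have "(\<Sum>z<n. l w z) =
        (\<Sum>z<n. (if z = w then int (out_degree G (vs ! w)) else 0) - of_bool (vs ! w \<rightarrow>\<^bsub>G\<^esub> vs ! z))"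
      by (intro sum.cong) (auto simp: l_def noloop)
    also have "\<dots> = int (out_degree G (vs ! w)) - (\<Sum>z<n. of_bool (vs ! w \<rightarrow>\<^bsub>G\<^esub> vs ! z))"
      using that by (simp add: sum_subtractf)
    also have "(\<Sum>z<n. of_bool (vs ! w \<rightarrow>\<^bsub>G\<^esub> vs ! z)) = (\<Sum>z\<in>verts G. of_bool (vs ! w \<rightarrow>\<^bsub>G\<^esub> z) :: int)"
      by (rule sum.reindex_bij_betw[OF bij])
    also have "\<dots> = int (card {z \<in> verts G. vs ! w \<rightarrow>\<^bsub>G\<^esub> z})"
      by (simp add: Int_def)
    also have "{z \<in> verts G. vs ! w \<rightarrow>\<^bsub>G\<^esub> z} = {z. vs ! w \<rightarrow>\<^bsub>G\<^esub> z}"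
      by (auto dest: adj_in_verts)
    finally show ?thesis
      by (simp add: out_degree_eq_card_dominated)
  qed
  have idx: "\<exists>i<n. vs ! i = u" if "u \<in> verts G" for u
    using that vs(2) len by (metis in_set_conv_nth)
  define r where "r = out_degree G (vs ! 0)"
  have reg: "l u u = int r" if "u < n" for u
  proof -
    have sq: "h z i * h z i = 1" if "z < n" "i < n" for z i
      using sgn[OF that] by (metis abs_mult_self_eq mult_1)
    \<comment> \<open>On the diagonal the signs are squared away, so the value does not depend on
      \<open>z\<close>.\<close>
    have "int n * l z z = (\<Sum>i<n. ev i)" if "z < n" for z
      using diagonalized_entry[of n h l ev z z] orth eig that by (simp add: sq)
    from this[OF that] this[of 0] have "int n * l u u = int n * l 0 0"
      by (simp add: n_def)
    then show ?thesis
      by (simp add: n_def r_def l_def)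
  qed
  show thesis
  proof (rule that[of r])
    fix u
    assume "u \<in> verts G"
    then show "card {v. u \<rightarrow>\<^bsub>G\<^esub> v} = r"
      using idx reg by (fastforce simp: l_def out_degree_eq_card_dominated)
  next
    fix u v w
    assume uvw: "u \<in> verts G" "v \<in> verts G" "w \<in> verts G" and ne: "u \<noteq> v" "u \<noteq> w" "v \<noteq> w"
    obtain a b c where abc: "a < n" "b < n" "c < n" "u = vs ! a" "v = vs ! b" "w = vs ! c"
      using idx uvw by metis
    then have "a \<noteq> b" "a \<noteq> c" "b \<noteq> c"
      using ne by auto
    with abc have "even (l a b + l c a + l c b + l c c)"
      by (intro diagonalized_triple_parity[where n = n and h = h and ev = ev and k = k] sgn orth eig row)
        (auto simp: n_def)
    then show "even (of_bool (u \<rightarrow>\<^bsub>G\<^esub> v) + of_bool (w \<rightarrow>\<^bsub>G\<^esub> u) + of_bool (w \<rightarrow>\<^bsub>G\<^esub> v) + r)"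
      using abc \<open>a \<noteq> b\<close> \<open>a \<noteq> c\<close> \<open>b \<noteq> c\<close> reg[of c] unfolding l_def
      by (auto simp: of_bool_def split: if_splits)
  qed
qed

section \<open>Regular graphs whose triples all have the same edge parity\<close>

text \<open>For triples containing a fixed vertex \<open>a\<close>, oddness says that the other two
  vertices are adjacent iff \<open>a\<close> is adjacent to both or to neither.\<close>

lemma (in graph) odd_triples_imp_cliques:
  assumes ne: "verts G \<noteq> {}"
    and reg: "\<And>u. u \<in> verts G \<Longrightarrow> card {v. u \<rightarrow>\<^bsub>G\<^esub> v} = r"
    and odd: "\<And>u v w. \<lbrakk>u \<in> verts G; v \<in> verts G; w \<in> verts G; u \<noteq> v; u \<noteq> w; v \<noteq> w\<rbrakk> \<Longrightarrow>
      odd (of_bool (u \<rightarrow>\<^bsub>G\<^esub> v) + of_bool (w \<rightarrow>\<^bsub>G\<^esub> u) + of_bool (w \<rightarrow>\<^bsub>G\<^esub> v) :: nat)"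
  shows "complete_digraph (card (verts G)) G \<or> two_complete_digraph (card (verts G) div 2) G"
proof -
  obtain a where a: "a \<in> verts G"
    using ne by auto
  have noloop: "\<not> u \<rightarrow>\<^bsub>G\<^esub> u" for u
    using no_loops by (auto simp: arcs_ends_def arc_to_ends_def)
  have sym: "u \<rightarrow>\<^bsub>G\<^esub> v \<longleftrightarrow> v \<rightarrow>\<^bsub>G\<^esub> u" for u v
    using arcs_ends_symmetric[OF sym_arcs] by blast
  define U where "U = insert a {v. a \<rightarrow>\<^bsub>G\<^esub> v}"
  define V where "V = verts G - U"
  have UV: "verts G = U \<union> V" "U \<inter> V = {}"
    using a adj_in_verts by (auto simp: U_def V_def)
  have fin: "finite U" "finite V"
    using UV(1) finite_verts by (metis finite_Un)+
  have adj: "u \<rightarrow>\<^bsub>G\<^esub> v \<longleftrightarrow> u \<noteq> v \<and> (u \<in> U \<longleftrightarrow> v \<in> U)" if "u \<in> verts G" "v \<in> verts G" for u v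
  proof (cases "u = a \<or> v = a \<or> u = v")
    case True
    then show ?thesis
      unfolding U_def using noloop sym by blast
  next
    case False
    then show ?thesis
      using odd[of u v a] that a
      by (cases "u \<rightarrow>\<^bsub>G\<^esub> v"; cases "a \<rightarrow>\<^bsub>G\<^esub> u"; cases "a \<rightarrow>\<^bsub>G\<^esub> v") (simp_all add: U_def)
  qed
  have "u \<rightarrow>\<^bsub>G\<^esub> v \<longleftrightarrow> (u, v) \<in> U \<times> U \<union> V \<times> V \<and> u \<noteq> v" for u v
    using adj[of u v] adj_in_verts[of u v] UV by blast
  then have ends: "arcs_ends G = {(u, v). (u, v) \<in> U \<times> U \<union> V \<times> V \<and> u \<noteq> v}"
    by auto
  have cU: "card U = Suc r"
    using reg[OF a] fin noloop unfolding U_def by simp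
  show ?thesis
  proof (cases "V = {}")
    case True
    then show ?thesis
      using ends UV graph_axioms by (auto simp: complete_digraph_def)
  next
    case False
    then obtain b where b: "b \<in> V"
      by auto
    \<comment> \<open>Regularity at \<open>b\<close> forces the second clique to have
      \<open>r + 1\<close> vertices, like \<open>U\<close>.\<close>
    have "{v. b \<rightarrow>\<^bsub>G\<^esub> v} = V - {b}"
      using b ends UV by auto
    then have "card V = Suc r"
      using reg[of b] b UV fin by (metis UnI2 card.remove)
    then have "two_complete_digraph (card (verts G) div 2) G"
      using ends UV cU fin graph_axioms unfolding two_complete_digraph_def
      by (intro conjI exI[of _ U] exI[of _ V]) (simp_all add: card_Un_disjoint)
    then show ?thesis ..
  qed
qed

text \<open>Evenness of triples containing \<open>a\<close> says that the other two vertices are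
  adjacent iff \<open>a\<close> is adjacent to exactly one of them.\<close>

lemma (in graph) even_triples_imp_bipartite:
  assumes ne: "verts G \<noteq> {}"
    and reg: "\<And>u. u \<in> verts G \<Longrightarrow> card {v. u \<rightarrow>\<^bsub>G\<^esub> v} = r"
    and even: "\<And>u v w. \<lbrakk>u \<in> verts G; v \<in> verts G; w \<in> verts G; u \<noteq> v; u \<noteq> w; v \<noteq> w\<rbrakk> \<Longrightarrow>
      even (of_bool (u \<rightarrow>\<^bsub>G\<^esub> v) + of_bool (w \<rightarrow>\<^bsub>G\<^esub> u) + of_bool (w \<rightarrow>\<^bsub>G\<^esub> v) :: nat)"
  shows "edgeless_digraph (card (verts G)) G \<or>
    complete_bipartite_digraph (card (verts G) div 2) (card (verts G) div 2) G"
proof -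
  obtain a where a: "a \<in> verts G"
    using ne by auto
  have noloop: "\<not> u \<rightarrow>\<^bsub>G\<^esub> u" for u
    using no_loops by (auto simp: arcs_ends_def arc_to_ends_def)
  have sym: "u \<rightarrow>\<^bsub>G\<^esub> v \<longleftrightarrow> v \<rightarrow>\<^bsub>G\<^esub> u" for u v
    using arcs_ends_symmetric[OF sym_arcs] by blast
  \<comment> \<open>The open neighbourhood is used, so that \<open>a\<close> falls into
    \<open>U\<close> with its non-neighbours.\<close>
  define V where "V = {v. a \<rightarrow>\<^bsub>G\<^esub> v}"
  define U where "U = verts G - V"
  have UV: "verts G = U \<union> V" "U \<inter> V = {}"
    using adj_in_verts by (auto simp: U_def V_def)
  have fin: "finite U" "finite V"
    using UV(1) finite_verts by (metis finite_Un)+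
  have adj: "u \<rightarrow>\<^bsub>G\<^esub> v \<longleftrightarrow> (u \<in> V \<longleftrightarrow> v \<notin> V)" if "u \<in> verts G" "v \<in> verts G" for u v
  proof (cases "u = a \<or> v = a \<or> u = v")
    case True
    then show ?thesis
      unfolding V_def using noloop sym by blast
  next
    case False
    then show ?thesis
      using even[of u v a] that a
      by (cases "u \<rightarrow>\<^bsub>G\<^esub> v"; cases "a \<rightarrow>\<^bsub>G\<^esub> u"; cases "a \<rightarrow>\<^bsub>G\<^esub> v") (simp_all add: V_def)
  qed
  have "u \<rightarrow>\<^bsub>G\<^esub> v \<longleftrightarrow> (u, v) \<in> U \<times> V \<union> V \<times> U" for u v
    using adj[of u v] adj_in_verts[of u v] UV by blast
  then have ends: "arcs_ends G = U \<times> V \<union> V \<times> U"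
    by auto
  have cV: "card V = r"
    using reg[OF a] unfolding V_def by simp
  show ?thesis
  proof (cases "V = {}")
    case True
    then show ?thesis
      using ends graph_axioms by (auto simp: edgeless_digraph_def)
  next
    case False
    then obtain b where b: "b \<in> V"
      by auto
    have "{v. b \<rightarrow>\<^bsub>G\<^esub> v} = U"
      using b ends UV by auto
    then have "card U = r"
      using reg[of b] b UV by auto
    then have "complete_bipartite_digraph (card (verts G) div 2) (card (verts G) div 2) G"
      using ends UV cV fin graph_axioms unfolding complete_bipartite_digraph_def
      by (intro conjI exI[of _ U] exI[of _ V]) (simp_all add: card_Un_disjoint)
    then show ?thesis ..
  qed
qed

theorem mainTheorem2:
  fixes G :: "('a, 'b) pre_digraph" and k n :: nat
  assumes "n = 8 * k + 4"
    and "graph G"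
    and "card (verts G) = n"
    and "hadamard_diagonalizable G"
  shows "complete_digraph n G \<or>
         complete_bipartite_digraph (n div 2) (n div 2) G \<or>
         edgeless_digraph n G \<or>
         two_complete_digraph (n div 2) G"
proof -
  interpret graph G
    by (rule assms)
  have ne: "verts G \<noteq> {}"
    using assms by auto
  obtain r where reg: "\<And>u. u \<in> verts G \<Longrightarrow> card {v. u \<rightarrow>\<^bsub>G\<^esub> v} = r"
    and par: "\<And>u v w. \<lbrakk>u \<in> verts G; v \<in> verts G; w \<in> verts G; u \<noteq> v; u \<noteq> w; v \<noteq> w\<rbrakk> \<Longrightarrow>
      even (of_bool (u \<rightarrow>\<^bsub>G\<^esub> v) + of_bool (w \<rightarrow>\<^bsub>G\<^esub> u) + of_bool (w \<rightarrow>\<^bsub>G\<^esub> v) + r)"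
    using hadamard_diagonalizable_triple_parity[of k] assms by metis
  \<comment> \<open>The parity of the common degree \<open>r\<close> decides whether all triples are
    even or all are odd.\<close>
  show ?thesis
  proof (cases "even r")
    case True
    with even_triples_imp_bipartite[OF ne reg] par assms(3) show ?thesis
      by auto
  next
    case False
    with odd_triples_imp_cliques[OF ne reg] par assms(3) show ?thesis
      by auto
  qed
qed

end
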